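(* Let $n,m\ge 2$, let $I=[a,b]$, $J=[c,d]$, and let $\mathcal D=\{(x_k,y_l,z_{k,l})\in\mathbb R^3 : 0\le k\le n,\ 0\le l\le m\}$ be a data set with $a=x_0<x_1<\dots<x_n=b$ and $c=y_0<y_1<\dots<y_m=d$, such that each of the four sets $\{(x_0,y_l,z_{0,l}) : 0\le l\le m\}$, $\{(x_n,y_l,z_{n,l}) : 0\le l\le m\}$, $\{(x_k,y_0,z_{k,0}) : 0\le k\le n\}$, $\{(x_k,y_m,z_{k,m}) : 0\le k\le n\}$ consists of collinear points. Let $g_{k,l}\in(0,1)$ for $1\le k\le n$, $1\le l\le m$ be arbitrary. Let the maps $F_{k,l}$, the metric $\rho$, the constant $\theta$, the constants $C_{k,l}$, the points $\gamma_{k,l}$, the number $M$ and the octahedrons $O[\cdot,\cdot]$ be as defined in the context. Let $f:I\times J\to\mathbb R$ be the continuous function with $f(x_k,y_l)=z_{k,l}$ for all $0\le k\le n$, $0\le l\le m$, whose graph $G_f=\{(x,y,f(x,y)) : (x,y)\in I\times J\}$ is the attractor of the iterated function system $((I\times J\times\mathbb R,\rho),(F_{k,l})_{1\le k\le n,\,1\le l\le m})$. Let $(k',l')$ be a pair with $$C_{k',l'}=\max_{1\le k\le n,\ 1\le l\le m}C_{k,l},$$ and let $(k'',l'')\ne(k',l')$ be a pair with $$C_{k'',l''}=\max_{(k,l)\neq(k',l')}C_{k,l}.$$ Then $$G_f\subseteq\left(\bigcup_{(k,l)\ne(k',l')}O\left[\gamma_{k,l},\,MC_{k,l}\frac{1+C_{k',l'}}{1-C_{k',l'}C_{k'',l''}}\right]\right)\cup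 O\left[\gamma_{k',l'},\,MC_{k',l'}\frac{1+C_{k'',l''}}{1-C_{k',l'}C_{k'',l''}}\right],$$ where $(k,l)$ ranges over $\{1,\dots,n\}\times\{1,\dots,m\}$.
   Context: For $k\in\{1,\dots,n\}$, $l\in\{1,\dots,m\}$ define $F_{k,l}:I\times J\times\mathbb R\to I\times J\times\mathbb R$ by $$F_{k,l}(x,y,z)=(a_kx+b_k,\ c_ly+d_l,\ e_{k,l}x+f_{k,l}y+g_{k,l}z+\alpha_{k,l}xy+\beta_{k,l}),$$ where $$a_k=\frac{x_k-x_{k-1}}{x_n-x_0},\quad b_k=\frac{x_{k-1}x_n-x_kx_0}{x_n-x_0},\quad c_l=\frac{y_l-y_{l-1}}{y_m-y_0},\quad d_l=\frac{y_{l-1}y_m-y_ly_0}{y_m-y_0},$$ and, with $p_{k,l}=z_{k,l}-g_{k,l}z_{n,m}$, $q_{k,l}=z_{k-1,l}-g_{k,l}z_{0,m}$, $r_{k,l}=z_{k,l-1}-g_{k,l}z_{n,0}$, $t_{k,l}=z_{k-1,l-1}-g_{k,l}z_{0,0}$ and $\Delta=(x_n-x_0)(y_m-y_0)$, $$\alpha_{k,l}=\frac{p_{k,l}-q_{k,l}-r_{k,l}+t_{k,l}}{\Delta},\quad e_{k,l}=\frac{y_0(q_{k,l}-p_{k,l})-y_m(t_{k,l}-r_{k,l})}{\Delta},$$ $$f_{k,l}=\frac{x_0(r_{k,l}-p_{k,l})-x_n(t_{k,l}-q_{k,l})}{\Delta},\quad \beta_{k,l}=\frac{y_0(x_0p_{k,l}-x_nq_{k,l})-y_m(x_0r_{k,l}-x_nt_{k,l})}{\Delta}.$$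 Equivalently, the coefficients are determined by $F_{k,l}(x_0,y_0,z_{0,0})=(x_{k-1},y_{l-1},z_{k-1,l-1})$, $F_{k,l}(x_n,y_0,z_{n,0})=(x_k,y_{l-1},z_{k,l-1})$, $F_{k,l}(x_0,y_m,z_{0,m})=(x_{k-1},y_l,z_{k-1,l})$, $F_{k,l}(x_n,y_m,z_{n,m})=(x_k,y_l,z_{k,l})$. Let $\delta=\max\{|a|,|b|,|c|,|d|\}$ and $\theta=\min\{\theta_1,\theta_2\}$, where: - $\theta_1=1$ if all $e_{k,l}$ and all $\alpha_{k,l}$ are $0$, and otherwise $\theta_1=\dfrac{1-\max_{k}a_k}{2\max_{k,l}(|e_{k,l}|+\delta|\alpha_{k,l}|)}$; - $\theta_2=1$ if all $f_{k,l}$ and all $\alpha_{k,l}$ are $0$, and otherwise $\theta_2=\dfrac{1-\max_{l}c_l}{2\max_{k,l}(|f_{k,l}|+\delta|\alpha_{k,l}|)}$ (with $k$ ranging over $\{1,\dots,n\}$ and $l$ over $\{1,\dots,m\}$). The metric $\rho$ on $\mathbb R^3$ is $\rho((x,y,z),(x',y',z'))=|x-x'|+|y-y'|+\theta|z-z'|$. For $r\ge0$ and $P\in\mathbb R^3$, $O[P,r]=\{Q\in\mathbb R^3:\rho(Q,P)\le r\}$ (an octahedron). For all $k,l$, $$C_{k,l}=\max\{a_k+\theta(|e_{k,l}|+\delta|\alpha_{k,l}|),\ c_l+\theta(|f_{k,l}|+\delta|\alpha_{k,l}|),\ g_{k,l}\},$$ which is less than $1$, and each $F_{k,l}$ satisfies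 $\rho(F_{k,l}(P),F_{k,l}(Q))\le C_{k,l}\,\rho(P,Q)$ for all $P,Q\in I\times J\times\mathbb R$. The fixed point of $F_{k,l}$ is $$\gamma_{k,l}=\left(\frac{b_k}{1-a_k},\ \frac{d_l}{1-c_l},\ \frac{1}{1-g_{k,l}}\left[e_{k,l}\frac{b_k}{1-a_k}+f_{k,l}\frac{d_l}{1-c_l}+\alpha_{k,l}\frac{b_kd_l}{(1-a_k)(1-c_l)}+\beta_{k,l}\right]\right),$$ and $M=\max\rho(\gamma_{i,j},\gamma_{k,l})$ over all $i,k\in\{1,\dots,n\}$ and $j,l\in\{1,\dots,m\}$. The attractor of an iterated function system $((X,d),(f_i)_{i\in I})$ (finitely many Banach contractions on a complete metric space) is the unique non-empty compact set $A\subseteq X$ with $A=\bigcup_{i}f_i(A)$. The existence of a continuous interpolating $f$ whose graph is the attractor is a known result of L. Dalla. *)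

theory Defs
  imports "HOL-Analysis.Analysis"
begin

text \<open>
  Uniqueness is part of the definition, since the attractor is \<^emph>\<open>the\<close> non-empty compact set
  with the invariance property. For finitely many Banach contractions of a complete metric space
  it is automatic. Compactness is taken in the topology of the metric \<open>d\<close> on \<open>X\<close>.
\<close>

definition invariant_compact ::
    "'p set \<Rightarrow> ('p \<Rightarrow> 'p \<Rightarrow> real) \<Rightarrow> 'i set \<Rightarrow> ('i \<Rightarrow> 'p \<Rightarrow> 'p) \<Rightarrow> 'p set \<Rightarrow> bool" where
  "invariant_compact X d S f A \<longleftrightarrow>
     A \<noteq> {} \<and> A \<subseteq> X \<and> compactin (Metric_space.mtopology X d) A \<and> A = (\<Union>i\<in>S. f i ` A)"

definition is_attractor ::
    "'p set \<Rightarrow> ('p \<Rightarrow> 'p \<Rightarrow> real) \<Rightarrow> 'i set \<Rightarrow> ('i \<Rightarrow> 'p \<Rightarrow> 'p) \<Rightarrow> 'p set \<Rightarrow> bool" where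
  "is_attractor X d S f A \<longleftrightarrow>
     invariant_compact X d S f A \<and> (\<forall>B. invariant_compact X d S f B \<longrightarrow> B = A)"

text \<open>
  The locale has no assumptions: it only fixes the grid \<open>x 0, \<dots>, x n\<close> and \<open>y 0, \<dots>, y m\<close>, the
  data \<open>z k l\<close> and the vertical scaling factors \<open>g k l\<close>. The intervals are \<open>I = [x 0, x n]\<close> and
  \<open>J = [y 0, y m]\<close>. The index pairs \<open>(k, l)\<close> of the maps start at 1, so that \<open>k - 1\<close> and \<open>l - 1\<close>
  are never truncated.
\<close>

locale bilinear_fis =
  fixes n m :: nat
    and x y :: "nat \<Rightarrow> real"
    and z g :: "nat \<Rightarrow> nat \<Rightarrow> real"
begin

definition idx :: "(nat \<times> nat) set" where
  "idx = {1..n} \<times> {1..m}"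

definition a_coeff :: "nat \<Rightarrow> real" where
  "a_coeff k = (x k - x (k - 1)) / (x n - x 0)"

definition b_coeff :: "nat \<Rightarrow> real" where
  "b_coeff k = (x (k - 1) * x n - x k * x 0) / (x n - x 0)"

definition c_coeff :: "nat \<Rightarrow> real" where
  "c_coeff l = (y l - y (l - 1)) / (y m - y 0)"

definition d_coeff :: "nat \<Rightarrow> real" where
  "d_coeff l = (y (l - 1) * y m - y l * y 0) / (y m - y 0)"

definition p :: "nat \<Rightarrow> nat \<Rightarrow> real" where
  "p k l = z k l - g k l * z n m"

definition q :: "nat \<Rightarrow> nat \<Rightarrow> real" where
  "q k l = z (k - 1) l - g k l * z 0 m"

definition r :: "nat \<Rightarrow> nat \<Rightarrow> real" where
  "r k l = z k (l - 1) - g k l * z n 0"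

definition t :: "nat \<Rightarrow> nat \<Rightarrow> real" where
  "t k l = z (k - 1) (l - 1) - g k l * z 0 0"

definition \<Delta> :: real where
  "\<Delta> = (x n - x 0) * (y m - y 0)"

definition \<alpha> :: "nat \<Rightarrow> nat \<Rightarrow> real" where
  "\<alpha> k l = (p k l - q k l - r k l + t k l) / \<Delta>"

definition e_coeff :: "nat \<Rightarrow> nat \<Rightarrow> real" where
  "e_coeff k l = (y 0 * (q k l - p k l) - y m * (t k l - r k l)) / \<Delta>"

definition f_coeff :: "nat \<Rightarrow> nat \<Rightarrow> real" where
  "f_coeff k l = (x 0 * (r k l - p k l) - x n * (t k l - q k l)) / \<Delta>"

definition \<beta> :: "nat \<Rightarrow> nat \<Rightarrow> real" where
  "\<beta> k l = (y 0 * (x 0 * p k l - x n * q k l) - y m * (x 0 * r k l - x n * t k l)) / \<Delta>"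

definition F :: "nat \<Rightarrow> nat \<Rightarrow> real \<times> real \<times> real \<Rightarrow> real \<times> real \<times> real" where
  "F k l = (\<lambda>(u, v, w).
     (a_coeff k * u + b_coeff k,
      c_coeff l * v + d_coeff l,
      e_coeff k l * u + f_coeff k l * v + g k l * w + \<alpha> k l * u * v + \<beta> k l))"

definition \<delta> :: real where
  "\<delta> = Max {\<bar>x 0\<bar>, \<bar>x n\<bar>, \<bar>y 0\<bar>, \<bar>y m\<bar>}"

definition \<theta>1 :: real where
  "\<theta>1 = (if \<forall>(k, l)\<in>idx. e_coeff k l = 0 \<and> \<alpha> k l = 0 then 1
     else (1 - Max (a_coeff ` {1..n}))
            / (2 * Max ((\<lambda>(k, l). \<bar>e_coeff k l\<bar> + \<delta> * \<bar>\<alpha> k l\<bar>) ` idx)))"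

definition \<theta>2 :: real where
  "\<theta>2 = (if \<forall>(k, l)\<in>idx. f_coeff k l = 0 \<and> \<alpha> k l = 0 then 1
     else (1 - Max (c_coeff ` {1..m}))
            / (2 * Max ((\<lambda>(k, l). \<bar>f_coeff k l\<bar> + \<delta> * \<bar>\<alpha> k l\<bar>) ` idx)))"

definition \<theta> :: real where
  "\<theta> = min \<theta>1 \<theta>2"

definition \<rho> :: "real \<times> real \<times> real \<Rightarrow> real \<times> real \<times> real \<Rightarrow> real" where
  "\<rho> = (\<lambda>(u, v, w) (u', v', w'). \<bar>u - u'\<bar> + \<bar>v - v'\<bar> + \<theta> * \<bar>w - w'\<bar>)"

definition octahedron :: "real \<times> real \<times> real \<Rightarrow> real \<Rightarrow> (real \<times> real \<times> real) set" where
  "octahedron P s = {Q. \<rho> Q P \<le> s}"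

definition C :: "nat \<Rightarrow> nat \<Rightarrow> real" where
  "C k l = Max {a_coeff k + \<theta> * (\<bar>e_coeff k l\<bar> + \<delta> * \<bar>\<alpha> k l\<bar>),
                c_coeff l + \<theta> * (\<bar>f_coeff k l\<bar> + \<delta> * \<bar>\<alpha> k l\<bar>),
                g k l}"

definition \<gamma> :: "nat \<Rightarrow> nat \<Rightarrow> real \<times> real \<times> real" where
  "\<gamma> k l =
     (b_coeff k / (1 - a_coeff k),
      d_coeff l / (1 - c_coeff l),
      1 / (1 - g k l) *
        (e_coeff k l * (b_coeff k / (1 - a_coeff k))
         + f_coeff k l * (d_coeff l / (1 - c_coeff l))
         + \<alpha> k l * ((b_coeff k * d_coeff l) / ((1 - a_coeff k) * (1 - c_coeff l)))
         + \<beta> k l))"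

definition M :: real where
  "M = Max {\<rho> (\<gamma> i j) (\<gamma> k l) | i j k l. (i, j) \<in> idx \<and> (k, l) \<in> idx}"

end

definition graph2 :: "(real \<times> real) set \<Rightarrow> (real \<times> real \<Rightarrow> real) \<Rightarrow> (real \<times> real \<times> real) set" where
  "graph2 D f = {(u, v, f (u, v)) | u v. (u, v) \<in> D}"

end

theory Submission
  imports Defs
begin

text \<open>
  Write \<open>s\<close> and \<open>t\<close> for the largest and second largest contraction ratios and \<open>R i\<close> for the radius of
  the ball around the fixed point \<open>\<gamma> i\<close>. The radii solve the system \<open>R i = c i * (R j + M)\<close> for the
  two extremal indices \<open>i\<close>, \<open>j\<close>. Hence a map \<open>F i\<close> sends a point at distance at most \<open>R j + e\<close>
  from \<open>\<gamma> j\<close> to a point at distance at most \<open>R i + s * e\<close> from \<open>\<gamma> i\<close>: the excess \<open>e\<close> of the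
  bounded invariant set over the union of the balls shrinks by the factor \<open>s < 1\<close>, so it vanishes.
\<close>

section \<open>Covering a bounded invariant set by balls around fixed points\<close>

lemma invariant_subset_Union_balls:
  fixes d :: "'p \<Rightarrow> 'p \<Rightarrow> real" and c :: "'i \<Rightarrow> real" and F :: "'i \<Rightarrow> 'p \<Rightarrow> 'p"
  assumes "finite S" and inv: "A = (\<Union>i\<in>S. F i ` A)" and "A \<subseteq> X"
    and tri: "\<And>P Q T. d P T \<le> d P Q + d Q T"
    and \<gamma>X: "\<And>i. i \<in> S \<Longrightarrow> \<gamma> i \<in> X"
    and fixpt: "\<And>i. i \<in> S \<Longrightarrow> F i (\<gamma> i) = \<gamma> i"
    and lip: "\<And>i P Q. i \<in> S \<Longrightarrow> P \<in> X \<Longrightarrow> Q \<in> X \<Longrightarrow> d (F i P) (F i Q) \<le> c i * d P Q"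
    and diam: "\<And>i j. i \<in> S \<Longrightarrow> j \<in> S \<Longrightarrow> d (\<gamma> i) (\<gamma> j) \<le> M" and "0 \<le> M"
    and i': "i' \<in> S" and bdd: "\<And>P. P \<in> A \<Longrightarrow> d P (\<gamma> i') \<le> B"
    and c0: "\<And>i. i \<in> S \<Longrightarrow> 0 \<le> c i" and ci': "c i' = s" and "s < 1"
    and ct: "\<And>i. i \<in> S \<Longrightarrow> i \<noteq> i' \<Longrightarrow> c i \<le> t" and "0 \<le> t" "t \<le> s"
  shows "A \<subseteq> (\<Union>i\<in>S - {i'}. {Q. d Q (\<gamma> i) \<le> M * c i * ((1 + s) / (1 - s * t))})
             \<union> {Q. d Q (\<gamma> i') \<le> M * s * ((1 + t) / (1 - s * t))}"
proof -
  define R where "R i = (if i = i' then M * s * ((1 + t) / (1 - s * t))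
                         else M * c i * ((1 + s) / (1 - s * t)))" for i
  have s0: "0 \<le> s" using \<open>0 \<le> t\<close> \<open>t \<le> s\<close> by linarith
  have "s * t \<le> s * 1" using s0 \<open>t \<le> s\<close> \<open>s < 1\<close> by (intro mult_left_mono) auto
  then have st: "0 < 1 - s * t" using \<open>s < 1\<close> by linarith
  \<comment> \<open>\<open>N\<close> is the factor common to all radii. Since
    \<open>M = N * (1 - s * t)\<close>, adding \<open>M\<close> to
    \<open>R i' = s * (N * (1 + t))\<close> gives exactly \<open>N * (1 + s)\<close>, the factor of
    \<open>c i\<close> in every other radius.\<close>
  define N where "N = M / (1 - s * t)"
  have N0: "0 \<le> N" using \<open>0 \<le> M\<close> st by (simp add: N_def)
  have MN: "M = N * (1 - s * t)" using st by (simp add: N_def)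
  have R': "R i' = s * (N * (1 + t))" by (simp add: R_def N_def)
  have Rn: "R i = c i * (N * (1 + s))" if "i \<noteq> i'" for i using that by (simp add: R_def N_def)
  have RM': "R i' + M = N * (1 + s)" unfolding R' by (subst MN) (simp add: algebra_simps)
  have RMn: "R j + M \<le> N * (1 + t)" if "j \<in> S" "j \<noteq> i'" for j
  proof -
    have "R j \<le> t * (N * (1 + s))"
      unfolding Rn[OF that(2)] using ct[OF that] N0 s0 by (intro mult_right_mono) auto
    moreover have "t * (N * (1 + s)) + M = N * (1 + t)" by (subst MN) (simp add: algebra_simps)
    ultimately show ?thesis by linarith
  qed
  have Nts: "N * (1 + t) \<le> N * (1 + s)" using N0 \<open>t \<le> s\<close> by (intro mult_left_mono) auto
  have cs: "c i \<le> s" if "i \<in> S" for i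
    using ct[OF that] ci' \<open>t \<le> s\<close> by (cases "i = i'") auto
  have step: "d (F i P) (\<gamma> i) \<le> R i + s * e"
    if i: "i \<in> S" and j: "j \<in> S" and P: "P \<in> A" and e: "0 \<le> e" and le: "d P (\<gamma> j) \<le> R j + e"
    for i j P e
  proof -
    have 1: "d (F i P) (\<gamma> i) \<le> c i * d P (\<gamma> i)"
      using lip[OF i, of P "\<gamma> i"] fixpt[OF i] \<gamma>X[OF i] P \<open>A \<subseteq> X\<close> by auto
    have 2: "d P (\<gamma> i) \<le> R j + e + M" using tri[of P "\<gamma> i" "\<gamma> j"] diam[OF j i] le by linarith
    have ce: "c i * e \<le> s * e" using cs[OF i] e by (intro mult_right_mono)
    show ?thesis
    proof (cases "i = i'")
      \<comment> \<open>Away from \<open>i'\<close> it does not matter which ball contains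
        \<open>P\<close>: because \<open>t \<le> s\<close>, the value \<open>N * (1 + s)\<close>
        bounds \<open>R j + M\<close> for every \<open>j\<close>.\<close>
      case False
      have "R j + M \<le> N * (1 + s)" using RM' RMn[OF j] Nts by (cases "j = i'") auto
      then have "c i * d P (\<gamma> i) \<le> c i * (N * (1 + s) + e)"
        using c0[OF i] 2 by (intro mult_left_mono) auto
      then show ?thesis using 1 ce Rn[OF False] by (simp add: distrib_left)
    next
      case True
      show ?thesis
      proof (cases "j = i'")
        \<comment> \<open>The sharper bound \<open>N * (1 + t)\<close> on \<open>R j + M\<close> is
          required here, as \<open>R i'\<close> is only \<open>s\<close> times that value.\<close>
        case False
        have "c i * d P (\<gamma> i) \<le> c i * (N * (1 + t) + e)"
          using c0[OF i] 2 RMn[OF j False] by (intro mult_left_mono) auto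
        then show ?thesis using 1 ce R' True ci' by (simp add: distrib_left)
      next
        \<comment> \<open>Passing through \<open>R i' + M = N * (1 + s)\<close> could overshoot. As
          the centre stays the same, contraction towards \<open>\<gamma> i'\<close> suffices without
          the extra \<open>M\<close>.\<close>
        case True': True
        have "0 \<le> R i'" unfolding R' using s0 N0 \<open>0 \<le> t\<close> by simp
        then have "s * R i' \<le> 1 * R i'" using \<open>s < 1\<close> by (intro mult_right_mono) auto
        moreover have "c i * d P (\<gamma> i) \<le> c i * (R i' + e)"
          using c0[OF i] le True True' by (intro mult_left_mono) auto
        ultimately show ?thesis using 1 True ci' by (simp add: distrib_left)
      qed
    qed
  qed
  \<comment> \<open>The initial excess is measured from the ball around \<open>\<gamma> i'\<close>.
    Cutting off at 0 provides the nonnegativity that \<open>step\<close> demands.\<close>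
  define E where "E = max 0 (B - R i')"
  have excess: "\<exists>j\<in>S. d P (\<gamma> j) \<le> R j + s ^ n * E" if "P \<in> A" for P n
    using that
  proof (induction n arbitrary: P)
    case 0
    show ?case using i' bdd[OF 0] by (intro bexI[of _ i']) (auto simp: E_def)
  next
    case (Suc n)
    \<comment> \<open>By invariance \<open>P\<close> has a preimage in \<open>A\<close>, to which
      the induction hypothesis applies; this is why \<open>P\<close> is generalised.\<close>
    obtain i P' where i: "i \<in> S" and P': "P' \<in> A" "P = F i P'"
      using Suc.prems inv by blast
    obtain j where "j \<in> S" "d P' (\<gamma> j) \<le> R j + s ^ n * E" using Suc.IH[OF P'(1)] by blast
    moreover have "0 \<le> s ^ n * E" using s0 by (simp add: E_def)
    ultimately have "d P (\<gamma> i) \<le> R i + s * (s ^ n * E)" using step[OF i _ P'(1)] P'(2) by blast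
    then show ?case using i by (auto simp: mult.assoc)
  qed
  have "\<exists>j\<in>S. d P (\<gamma> j) \<le> R j" if P: "P \<in> A" for P
  proof (rule ccontr)
    assume far: "\<not> ?thesis"
    \<comment> \<open>The index \<open>j\<close> from \<open>excess\<close> varies with
      \<open>n\<close>. Since \<open>S\<close> is finite, the gaps to all balls have a positive
      minimum, which the vanishing excess eventually undercuts.\<close>
    define \<epsilon> where "\<epsilon> = Min ((\<lambda>j. d P (\<gamma> j) - R j) ` S)"
    have "0 < \<epsilon>" unfolding \<epsilon>_def using far \<open>finite S\<close> i' by (subst Min_gr_iff) auto
    moreover have "(\<lambda>n. s ^ n * E) \<longlonglongrightarrow> 0"
      using s0 \<open>s < 1\<close> by (intro tendsto_mult_left_zero LIMSEQ_realpow_zero)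
    ultimately have "eventually (\<lambda>n. s ^ n * E < \<epsilon>) sequentially" by (simp add: order_tendsto_iff)
    then obtain n where n: "s ^ n * E < \<epsilon>" by (auto simp: eventually_sequentially)
    obtain j where j: "j \<in> S" "d P (\<gamma> j) \<le> R j + s ^ n * E" using excess[OF P] by blast
    have "\<epsilon> \<le> d P (\<gamma> j) - R j" unfolding \<epsilon>_def using \<open>finite S\<close> j(1) by (intro Min_le) auto
    then show False using n j by linarith
  qed
  then show ?thesis unfolding R_def by (fastforce split: if_splits)
qed

section \<open>Affine interval maps, the choice of the metric weight, and grids\<close>

text \<open>The map \<open>\<lambda>w. a * w + b\<close> sends \<open>s\<close> to \<open>u\<close>
  and \<open>e\<close> to \<open>v\<close>. As \<open>{u..v}\<close> is a proper part of
  \<open>{s..e}\<close>, the slope is below 1, and the fixed point \<open>b / (1 - a)\<close> stays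
  in \<open>{s..e}\<close> because the map sends that interval into itself.\<close>

lemma affine_interval_map:
  fixes s e u v :: real
  assumes "s < e" and "s \<le> u" "u \<le> v" "v \<le> e" and "(s, e) \<noteq> (u, v)"
  defines "a \<equiv> (v - u) / (e - s)" and "b \<equiv> (u * e - v * s) / (e - s)"
  shows "0 \<le> a" and "a < 1" and "b / (1 - a) \<in> {s..e}"
proof -
  show 0: "0 \<le> a" and 1: "a < 1" using assms by (auto simp: divide_simps)
  have "a * s + b = u" "a * e + b = v"
    unfolding a_def b_def using assms(1) by (auto simp: divide_simps) (auto simp: algebra_simps)
  then have "s * (1 - a) \<le> b" "b \<le> e * (1 - a)" using assms by (auto simp: algebra_simps)
  then show "b / (1 - a) \<in> {s..e}" using 1 by (simp add: pos_le_divide_eq pos_divide_le_eq)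
qed

text \<open>
  The quotient is an abstraction of both \<open>\<theta>1\<close> and \<open>\<theta>2\<close>. Its denominator may vanish, in which case
  it is \<open>0\<close> and the bound is trivial.
\<close>

lemma half_gap_bound:
  fixes h :: "'i \<Rightarrow> real" and A \<tau> :: real
  assumes "finite S" "i \<in> S" "0 \<le> h i" "A < 1" "0 \<le> \<tau>" "\<tau> \<le> (1 - A) / (2 * Max (h ` S))"
  shows "A + \<tau> * h i < 1"
proof -
  have hM: "h i \<le> Max (h ` S)" using assms by simp
  have "\<tau> * h i \<le> (1 - A) / (2 * Max (h ` S)) * Max (h ` S)"
    using assms hM by (intro mult_mono) auto
  also have "\<dots> \<le> (1 - A) / 2" using assms by (cases "Max (h ` S) = 0") auto
  finally show ?thesis using \<open>A < 1\<close> by simp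
qed

lemma strictly_increasing_less:
  fixes x :: "nat \<Rightarrow> real"
  assumes "\<And>k. k < n \<Longrightarrow> x k < x (Suc k)" "i < j" "j \<le> n"
  shows "x i < x j"
  using assms(2,3)
proof (induction j)
  case (Suc j)
  then show ?case using assms(1)[of j] by (cases "i = j") auto
qed simp

text \<open>Supplies the hypotheses of \<open>affine_interval_map\<close>. With at least two cells,
  each cell misses an end of the whole interval: the last one misses \<open>x 0\<close>, any other
  misses \<open>x n\<close>.\<close>

lemma strictly_increasing_subinterval:
  fixes x :: "nat \<Rightarrow> real"
  assumes inc: "\<And>k. k < n \<Longrightarrow> x k < x (Suc k)" and "2 \<le> n" and k: "k \<in> {1..n}"
  shows "x 0 < x n" "x 0 \<le> x (k - 1)" "x (k - 1) \<le> x k" "x k \<le> x n" "(x 0, x n) \<noteq> (x (k - 1), x k)"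
proof -
  note less = strictly_increasing_less[of n x, OF inc]
  have le: "x i \<le> x j" if "i \<le> j" "j \<le> n" for i j
    using less[of i j] that by (cases "i = j") auto
  show "x 0 < x n" using less[of 0 n] \<open>2 \<le> n\<close> by auto
  show "x 0 \<le> x (k - 1)" "x (k - 1) \<le> x k" "x k \<le> x n" using k by (auto intro!: le)
  show "(x 0, x n) \<noteq> (x (k - 1), x k)"
    using less[of 0 "k - 1"] less[of k n] \<open>2 \<le> n\<close> k by (cases "k = n") auto
qed

section \<open>Contraction estimates and fixed points of the bilinear maps\<close>

locale bilinear_fis_grid = bilinear_fis +
  assumes n2: "2 \<le> n" and m2: "2 \<le> m"
    and x_inc: "\<And>k. k < n \<Longrightarrow> x k < x (Suc k)"
    and y_inc: "\<And>l. l < m \<Longrightarrow> y l < y (Suc l)"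
    and g_bounds: "\<And>k l. (k, l) \<in> idx \<Longrightarrow> 0 < g k l \<and> g k l < 1"
begin

lemma finite_idx: "finite idx" by (simp add: idx_def)

lemma a_coeff_bounds:
  assumes "k \<in> {1..n}"
  shows "0 \<le> a_coeff k" "a_coeff k < 1" "b_coeff k / (1 - a_coeff k) \<in> {x 0..x n}"
  unfolding a_coeff_def b_coeff_def
  using affine_interval_map[OF strictly_increasing_subinterval[of n x, OF x_inc n2 assms]] by auto

lemma c_coeff_bounds:
  assumes "l \<in> {1..m}"
  shows "0 \<le> c_coeff l" "c_coeff l < 1" "d_coeff l / (1 - c_coeff l) \<in> {y 0..y m}"
  unfolding c_coeff_def d_coeff_def
  using affine_interval_map[OF strictly_increasing_subinterval[of m y, OF y_inc m2 assms]] by auto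

lemma abs_le_\<delta>:
  shows "u \<in> {x 0..x n} \<Longrightarrow> \<bar>u\<bar> \<le> \<delta>" and "v \<in> {y 0..y m} \<Longrightarrow> \<bar>v\<bar> \<le> \<delta>"
  unfolding \<delta>_def by (auto simp: le_max_iff_disj abs_if)

lemma \<delta>_nonneg: "0 \<le> \<delta>"
  unfolding \<delta>_def by (simp add: le_max_iff_disj)

lemma Max_a_coeff_less_1: "Max (a_coeff ` {1..n}) < 1"
  using a_coeff_bounds(2) n2 by (subst Max_less_iff) auto

lemma Max_c_coeff_less_1: "Max (c_coeff ` {1..m}) < 1"
  using c_coeff_bounds(2) m2 by (subst Max_less_iff) auto

text \<open>Both numerators are positive because the slopes stay below 1, and both maxima dominate
  their nonnegative value at \<open>(1, 1)\<close>. Nonnegativity is enough later, where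
  inequalities are multiplied by \<open>\<theta>\<close> but never divided by it.\<close>

lemma \<theta>_nonneg: "0 \<le> \<theta>"
proof -
  have kl: "(1, 1) \<in> idx" using n2 m2 by (simp add: idx_def)
  have "0 \<le> (case (1, 1) of (k, l) \<Rightarrow> \<bar>h k l\<bar> + \<delta> * \<bar>\<alpha> k l\<bar>)" for h using \<delta>_nonneg by simp
  then have "0 \<le> Max ((\<lambda>(k, l). \<bar>h k l\<bar> + \<delta> * \<bar>\<alpha> k l\<bar>) ` idx)" for h :: "nat \<Rightarrow> nat \<Rightarrow> real"
    using kl finite_idx by (intro order_trans[OF _ Max_ge[OF _ imageI[OF kl]]]) auto
  then show ?thesis
    unfolding \<theta>_def \<theta>1_def \<theta>2_def using Max_a_coeff_less_1 Max_c_coeff_less_1 by auto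
qed

text \<open>The weight \<open>\<theta>\<close> is chosen so that the mixed terms use up at most half
  of the gap between the largest slope and 1. If the relevant coefficients all vanish, there is no
  mixed term and the slope alone is below 1.\<close>

lemma C_bounds:
  assumes kl: "(k, l) \<in> idx"
  shows "0 \<le> C k l" "C k l < 1"
proof -
  have k: "k \<in> {1..n}" and l: "l \<in> {1..m}" using kl by (auto simp: idx_def)
  show "0 \<le> C k l" unfolding C_def using g_bounds[OF kl] by (simp add: le_max_iff_disj)
  have "a_coeff k + \<theta> * (\<bar>e_coeff k l\<bar> + \<delta> * \<bar>\<alpha> k l\<bar>) < 1"
  proof (cases "\<forall>(k, l)\<in>idx. e_coeff k l = 0 \<and> \<alpha> k l = 0")
    case True
    then show ?thesis using kl a_coeff_bounds(2)[OF k] by fastforce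
  next
    case False
    have "Max (a_coeff ` {1..n}) +
        \<theta> * (\<lambda>(k, l). \<bar>e_coeff k l\<bar> + \<delta> * \<bar>\<alpha> k l\<bar>) (k, l) < 1"
      using False \<delta>_nonneg
      by (intro half_gap_bound[OF finite_idx kl _ Max_a_coeff_less_1 \<theta>_nonneg])
        (auto simp: \<theta>_def \<theta>1_def)
    moreover have "a_coeff k \<le> Max (a_coeff ` {1..n})" using k by (intro Max_ge) auto
    ultimately show ?thesis by simp
  qed
  moreover have "c_coeff l + \<theta> * (\<bar>f_coeff k l\<bar> + \<delta> * \<bar>\<alpha> k l\<bar>) < 1"
  proof (cases "\<forall>(k, l)\<in>idx. f_coeff k l = 0 \<and> \<alpha> k l = 0")
    case True
    then show ?thesis using kl c_coeff_bounds(2)[OF l] by fastforce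
  next
    case False
    have "Max (c_coeff ` {1..m}) +
        \<theta> * (\<lambda>(k, l). \<bar>f_coeff k l\<bar> + \<delta> * \<bar>\<alpha> k l\<bar>) (k, l) < 1"
      using False \<delta>_nonneg
      by (intro half_gap_bound[OF finite_idx kl _ Max_c_coeff_less_1 \<theta>_nonneg])
        (auto simp: \<theta>_def \<theta>2_def)
    moreover have "c_coeff l \<le> Max (c_coeff ` {1..m})" using l by (intro Max_ge) auto
    ultimately show ?thesis by simp
  qed
  ultimately show "C k l < 1" unfolding C_def using g_bounds[OF kl] by simp
qed

text \<open>The only nonlinear term is the product of the first two coordinates. On the box its
  variation is at most \<open>\<delta>\<close> times the sum of the variations of the factors, so
  \<open>\<delta> * \<bar>\<alpha> k l\<bar>\<close> is charged to both the first and the second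
  coordinate, as in the entries of \<open>C k l\<close>.\<close>

lemma F_lipschitz:
  assumes kl: "(k, l) \<in> idx"
    and P: "P \<in> {x 0..x n} \<times> {y 0..y m} \<times> UNIV" and Q: "Q \<in> {x 0..x n} \<times> {y 0..y m} \<times> UNIV"
  shows "\<rho> (F k l P) (F k l Q) \<le> C k l * \<rho> P Q"
proof -
  obtain u v w where P_eq: "P = (u, v, w)" by (cases P)
  obtain u' v' w' where Q_eq: "Q = (u', v', w')" by (cases Q)
  have k: "k \<in> {1..n}" and l: "l \<in> {1..m}" using kl by (auto simp: idx_def)
  define U V W where "U = \<bar>u - u'\<bar>" and "V = \<bar>v - v'\<bar>" and "W = \<bar>w - w'\<bar>"
  have uvw: "0 \<le> U" "0 \<le> V" "0 \<le> W" by (auto simp: U_def V_def W_def)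
  \<comment> \<open>Changing one factor at a time leaves the multipliers \<open>u\<close> and
    \<open>v'\<close>, each bounded by \<open>\<delta>\<close> on the box.\<close>
  have "u * v - u' * v' = u * (v - v') + v' * (u - u')" by (simp add: algebra_simps)
  then have "\<bar>u * v - u' * v'\<bar> \<le> \<bar>u\<bar> * V + \<bar>v'\<bar> * U"
    by (metis U_def V_def abs_mult abs_triangle_ineq)
  also have "\<dots> \<le> \<delta> * V + \<delta> * U"
    using uvw P Q abs_le_\<delta> by (intro add_mono mult_right_mono) (auto simp: P_eq Q_eq)
  finally have uv: "\<bar>u * v - u' * v'\<bar> \<le> \<delta> * V + \<delta> * U" .
  have "(e_coeff k l * u + f_coeff k l * v + g k l * w + \<alpha> k l * u * v + \<beta> k l)
      - (e_coeff k l * u' + f_coeff k l * v' + g k l * w' + \<alpha> k l * u' * v' + \<beta> k l)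
      = e_coeff k l * (u - u') + f_coeff k l * (v - v') + g k l * (w - w')
        + \<alpha> k l * (u * v - u' * v')" (is "?Z = _") by (simp add: algebra_simps)
  then have "\<bar>?Z\<bar> \<le> \<bar>e_coeff k l * (u - u')\<bar> + \<bar>f_coeff k l * (v - v')\<bar>
      + \<bar>g k l * (w - w')\<bar> + \<bar>\<alpha> k l * (u * v - u' * v')\<bar>" by linarith
  also have "\<dots> = \<bar>e_coeff k l\<bar> * U + \<bar>f_coeff k l\<bar> * V + g k l * W
      + \<bar>\<alpha> k l\<bar> * \<bar>u * v - u' * v'\<bar>"
    using g_bounds[OF kl] by (simp add: abs_mult U_def V_def W_def)
  also have "\<dots> \<le> \<bar>e_coeff k l\<bar> * U + \<bar>f_coeff k l\<bar> * V + g k l * W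
      + \<bar>\<alpha> k l\<bar> * (\<delta> * V + \<delta> * U)"
    using uv by (intro add_left_mono mult_left_mono) auto
  finally have "\<theta> * \<bar>?Z\<bar> \<le> \<theta> * (\<bar>e_coeff k l\<bar> * U + \<bar>f_coeff k l\<bar> * V + g k l * W
      + \<bar>\<alpha> k l\<bar> * (\<delta> * V + \<delta> * U))"
    using \<theta>_nonneg by (rule mult_left_mono)
  moreover have "\<bar>a_coeff k * u + b_coeff k - (a_coeff k * u' + b_coeff k)\<bar> = a_coeff k * U"
    using a_coeff_bounds(1)[OF k] abs_mult[of "a_coeff k" "u - u'"]
    by (simp add: U_def right_diff_distrib)
  moreover have "\<bar>c_coeff l * v + d_coeff l - (c_coeff l * v' + d_coeff l)\<bar> = c_coeff l * V"
    using c_coeff_bounds(1)[OF l] abs_mult[of "c_coeff l" "v - v'"]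
    by (simp add: V_def right_diff_distrib)
  ultimately have "\<rho> (F k l P) (F k l Q)
      \<le> (a_coeff k + \<theta> * (\<bar>e_coeff k l\<bar> + \<delta> * \<bar>\<alpha> k l\<bar>)) * U
        + (c_coeff l + \<theta> * (\<bar>f_coeff k l\<bar> + \<delta> * \<bar>\<alpha> k l\<bar>)) * V + g k l * (\<theta> * W)"
    by (simp add: \<rho>_def F_def P_eq Q_eq algebra_simps)
  also have "\<dots> \<le> C k l * U + C k l * V + C k l * (\<theta> * W)"
    using uvw \<theta>_nonneg by (intro add_mono mult_right_mono) (auto simp: C_def le_max_iff_disj)
  finally show ?thesis by (simp add: \<rho>_def P_eq Q_eq U_def V_def W_def algebra_simps)
qed

lemma F_\<gamma>:
  assumes kl: "(k, l) \<in> idx"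
  shows "F k l (\<gamma> k l) = \<gamma> k l"
proof -
  have fixed: "s * (b / (1 - s)) + b = b / (1 - s)" if "s < 1" for s b :: real
    using that by (simp add: field_simps)
  have less_1: "a_coeff k < 1" "c_coeff l < 1" "g k l < 1"
    using kl a_coeff_bounds(2) c_coeff_bounds(2) g_bounds[OF kl] by (auto simp: idx_def)
  \<comment> \<open>Once the first two coordinates are fixed, the third is affine with slope
    \<open>g k l\<close> and constant term \<open>h\<close>, so the same one-dimensional fixed point
    formula solves all three.\<close>
  define u v h where "u = b_coeff k / (1 - a_coeff k)" and "v = d_coeff l / (1 - c_coeff l)"
    and "h = e_coeff k l * u + f_coeff k l * v + \<alpha> k l * (u * v) + \<beta> k l"
  have "\<gamma> k l = (u, v, h / (1 - g k l))"
    by (simp add: \<gamma>_def u_def v_def h_def)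
  moreover have "a_coeff k * u + b_coeff k = u" "c_coeff l * v + d_coeff l = v"
    using fixed less_1 by (simp_all add: u_def v_def)
  moreover have "e_coeff k l * u + f_coeff k l * v + g k l * (h / (1 - g k l))
      + \<alpha> k l * u * v + \<beta> k l = h / (1 - g k l)"
    using fixed[OF less_1(3), of h] by (simp add: h_def)
  ultimately show ?thesis by (simp add: F_def)
qed

text \<open>Allows a fixed point as one of the two arguments of \<open>F_lipschitz\<close>, which is
  confined to the box.\<close>

lemma \<gamma>_in_box: "(k, l) \<in> idx \<Longrightarrow> \<gamma> k l \<in> {x 0..x n} \<times> {y 0..y m} \<times> UNIV"
  using a_coeff_bounds(3) c_coeff_bounds(3) unfolding \<gamma>_def idx_def by blast

section \<open>Metric properties and boundedness of the graph\<close>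

lemma \<rho>_nonneg: "0 \<le> \<rho> P Q"
  unfolding \<rho>_def using \<theta>_nonneg by (auto split: prod.splits)

lemma \<rho>_triangle: "\<rho> P T \<le> \<rho> P Q + \<rho> Q T"
proof -
  obtain u v w where P: "P = (u, v, w)" by (cases P)
  obtain u' v' w' where Q: "Q = (u', v', w')" by (cases Q)
  obtain u'' v'' w'' where T: "T = (u'', v'', w'')" by (cases T)
  have "\<theta> * \<bar>w - w''\<bar> \<le> \<theta> * (\<bar>w - w'\<bar> + \<bar>w' - w''\<bar>)"
    using \<theta>_nonneg by (intro mult_left_mono) auto
  then have "\<bar>u - u''\<bar> + \<bar>v - v''\<bar> + \<theta> * \<bar>w - w''\<bar>
      \<le> (\<bar>u - u'\<bar> + \<bar>v - v'\<bar> + \<theta> * \<bar>w - w'\<bar>) + (\<bar>u' - u''\<bar> + \<bar>v' - v''\<bar> + \<theta> * \<bar>w' - w''\<bar>)"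
    unfolding distrib_left by linarith
  then show ?thesis by (simp add: P Q T \<rho>_def)
qed

lemma \<rho>_\<gamma>_le_M:
  assumes "(i, j) \<in> idx" "(k, l) \<in> idx"
  shows "\<rho> (\<gamma> i j) (\<gamma> k l) \<le> M"
proof -
  let ?S = "{\<rho> (\<gamma> i j) (\<gamma> k l) | i j k l. (i, j) \<in> idx \<and> (k, l) \<in> idx}"
  have "?S \<subseteq> (\<lambda>(P, Q). \<rho> (\<gamma> (fst P) (snd P)) (\<gamma> (fst Q) (snd Q))) ` (idx \<times> idx)" by force
  then have "finite ?S" by (rule finite_subset) (simp add: finite_idx)
  then show ?thesis unfolding M_def using assms by (intro Max_ge) auto
qed

text \<open>Provides the finite starting excess for the covering argument. A continuous function on
  the compact rectangle is bounded, which bounds the distance to the origin; the triangle inequality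
  then moves the reference point to \<open>Q\<close>.\<close>

lemma \<rho>_bounded_on_graph2:
  assumes "continuous_on ({x 0..x n} \<times> {y 0..y m}) f"
  shows "\<exists>B. \<forall>P\<in>graph2 ({x 0..x n} \<times> {y 0..y m}) f. \<rho> P Q \<le> B"
proof -
  let ?D = "{x 0..x n} \<times> {y 0..y m}"
  have "compact (f ` ?D)"
    using assms by (intro compact_continuous_image compact_Times) auto
  then have "bounded (f ` ?D)" by (rule compact_imp_bounded)
  then obtain b where b: "\<And>P. P \<in> ?D \<Longrightarrow> \<bar>f P\<bar> \<le> b"
    unfolding bounded_iff by (metis imageI real_norm_def)
  have "\<rho> P 0 \<le> \<delta> + \<delta> + \<theta> * b" if P: "P \<in> graph2 ?D f" for P
  proof -
    obtain u v where uv: "P = (u, v, f (u, v))" "(u, v) \<in> ?D" using P unfolding graph2_def by blast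
    have "\<theta> * \<bar>f (u, v)\<bar> \<le> \<theta> * b" using b[OF uv(2)] \<theta>_nonneg by (rule mult_left_mono)
    moreover have "\<bar>u\<bar> \<le> \<delta>" "\<bar>v\<bar> \<le> \<delta>" using uv(2) abs_le_\<delta> by auto
    ultimately show ?thesis by (simp add: uv(1) \<rho>_def zero_prod_def)
  qed
  then show ?thesis using \<rho>_triangle[of _ Q 0] by (meson add_right_mono order_trans)
qed

end

section \<open>Application to the graph of the interpolating function\<close>

theorem theorem4p1:
  fixes n m :: nat
    and x y :: "nat \<Rightarrow> real"
    and z g :: "nat \<Rightarrow> nat \<Rightarrow> real"
    and f :: "real \<times> real \<Rightarrow> real"
    and k' l' k'' l'' :: nat
  defines "C \<equiv> bilinear_fis.C n m x y z g"
    and "M \<equiv> bilinear_fis.M n m x y z g"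
    and "\<gamma> \<equiv> bilinear_fis.\<gamma> n m x y z g"
    and "Oct \<equiv> bilinear_fis.octahedron n m x y z g"
    and "K \<equiv> {1..n} \<times> {1..m}"
    and "D \<equiv> {x 0..x n} \<times> {y 0..y m}"
  assumes "n \<ge> 2" and "m \<ge> 2"
    and "\<And>k. k < n \<Longrightarrow> x k < x (Suc k)"
    and "\<And>l. l < m \<Longrightarrow> y l < y (Suc l)"
    and "collinear {(x 0, y l, z 0 l) | l. l \<le> m}"
    and "collinear {(x n, y l, z n l) | l. l \<le> m}"
    and "collinear {(x k, y 0, z k 0) | k. k \<le> n}"
    and "collinear {(x k, y m, z k m) | k. k \<le> n}"
    and "\<And>k l. (k, l) \<in> K \<Longrightarrow> 0 < g k l \<and> g k l < 1"
    and "continuous_on D f"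
    and "\<And>k l. k \<le> n \<Longrightarrow> l \<le> m \<Longrightarrow> f (x k, y l) = z k l"
    and "is_attractor ({x 0..x n} \<times> {y 0..y m} \<times> UNIV) (bilinear_fis.\<rho> n m x y z g)
           K (\<lambda>(k, l). bilinear_fis.F n m x y z g k l) (graph2 D f)"
    and "(k', l') \<in> K"
    and "C k' l' = Max ((\<lambda>(k, l). C k l) ` K)"
    and "(k'', l'') \<in> K" and "(k'', l'') \<noteq> (k', l')"
    and "C k'' l'' = Max ((\<lambda>(k, l). C k l) ` (K - {(k', l')}))"
  shows "graph2 D f \<subseteq>
      (\<Union>(k, l)\<in>K - {(k', l')}.
         Oct (\<gamma> k l) (M * C k l * ((1 + C k' l') / (1 - C k' l' * C k'' l''))))
      \<union> Oct (\<gamma> k' l') (M * C k' l' * ((1 + C k'' l'') / (1 - C k' l' * C k'' l'')))"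
proof -
  interpret bilinear_fis_grid n m x y z g
    using assms(7-10,15) by unfold_locales (auto simp: K_def bilinear_fis.idx_def)
  let ?G = "graph2 D f" and ?X = "{x 0..x n} \<times> {y 0..y m} \<times> (UNIV :: real set)"
  have K: "K = idx" by (simp add: K_def idx_def)
  have "invariant_compact ?X \<rho> K (\<lambda>(k, l). F k l) ?G"
    using assms(18) by (simp add: is_attractor_def)
  then have inv: "?G = (\<Union>i\<in>K. (case i of (k, l) \<Rightarrow> F k l) ` ?G)" and sub: "?G \<subseteq> ?X"
    unfolding invariant_compact_def by blast+
  obtain B where B: "\<And>P. P \<in> ?G \<Longrightarrow> \<rho> P (\<gamma> k' l') \<le> B"
    using \<rho>_bounded_on_graph2[of f "\<gamma> k' l'"] assms(16) unfolding D_def by blast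
  have fin: "finite K" by (simp add: K_def)
  have t: "C k l \<le> C k'' l''" if "(k, l) \<in> K" "(k, l) \<noteq> (k', l')" for k l
    unfolding assms(23) using fin that by (intro Max_ge) auto
  have s: "C k'' l'' \<le> C k' l'" unfolding assms(20) using fin assms(21) by (intro Max_ge) auto
  have C: "0 \<le> C k l \<and> C k l < 1" if "(k, l) \<in> K" for k l
    using C_bounds that unfolding K assms(1) by blast
  \<comment> \<open>\<open>M\<close> dominates the distance of \<open>\<gamma> k' l'\<close> to
    itself, which is nonnegative.\<close>
  have M0: "0 \<le> M"
    using \<rho>_\<gamma>_le_M[of k' l' k' l'] \<rho>_nonneg assms(19) order_trans unfolding K assms(2) by blast
  \<comment> \<open>The covering lemma uses a single index, so pairs are passed through case
    expressions. Its \<open>s\<close> is \<open>C k' l'\<close> and its \<open>t\<close> is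
    \<open>C k'' l''\<close>.\<close>
  have "?G \<subseteq> (\<Union>i\<in>K - {(k', l')}. {Q. \<rho> Q (case i of (k, l) \<Rightarrow> \<gamma> k l)
        \<le> M * (case i of (k, l) \<Rightarrow> C k l) * ((1 + C k' l') / (1 - C k' l' * C k'' l''))})
    \<union> {Q. \<rho> Q (case (k', l') of (k, l) \<Rightarrow> \<gamma> k l)
        \<le> M * C k' l' * ((1 + C k'' l'') / (1 - C k' l' * C k'' l''))}"
    using fin inv sub
  proof (rule invariant_subset_Union_balls[where B = B])
    fix i assume "i \<in> K"
    then show "(case i of (k, l) \<Rightarrow> \<gamma> k l) \<in> ?X"
      and "(case i of (k, l) \<Rightarrow> F k l) (case i of (k, l) \<Rightarrow> \<gamma> k l) = (case i of (k, l) \<Rightarrow> \<gamma> k l)"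
      using \<gamma>_in_box F_\<gamma> unfolding K assms(3) by (auto split: prod.splits)
  next
    fix i P Q assume "i \<in> K" "P \<in> ?X" "Q \<in> ?X"
    then show "\<rho> ((case i of (k, l) \<Rightarrow> F k l) P) ((case i of (k, l) \<Rightarrow> F k l) Q)
        \<le> (case i of (k, l) \<Rightarrow> C k l) * \<rho> P Q"
      using F_lipschitz unfolding K assms(1) by (auto split: prod.splits)
  next
    fix i j assume "i \<in> K" "j \<in> K"
    then show "\<rho> (case i of (k, l) \<Rightarrow> \<gamma> k l) (case j of (k, l) \<Rightarrow> \<gamma> k l) \<le> M"
      using \<rho>_\<gamma>_le_M unfolding K assms(2,3) by (auto split: prod.splits)
  next
    fix i assume "i \<in> K" "i \<noteq> (k', l')"
    then show "(case i of (k, l) \<Rightarrow> C k l) \<le> C k'' l''"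
      using t by (cases i) simp
  qed (use \<rho>_triangle M0 B C s assms(19,21) in \<open>auto split: prod.splits\<close>)
  then show ?thesis unfolding Oct_def octahedron_def by (auto split: prod.splits)
qed

end
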